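(* Let $\mathbf{Set}_0$ be a full subcategory of $\mathbf{Set}$ containing all $[c]=\{1,\dots,c\}$, $c\in\mathbb Z_{\ge0}$, and closed with respect to subsets. Let $M$ be a finite set and let $F$ be an $M$-admissible functor $\mathbf{Set}_0\to\mathbf{Set}$. Then $|F(C)|=p_F(|C|)$ for any finite $C\in\operatorname{Ob}(\mathbf{Set}_0)$, where $p_F$ is the polynomial $$p_F=\sum_{k\ge1}\left\{{M\atop k}\right\}_F\, x(x-1)\cdots(x-k+1)\in\mathbb Z[x].$$
   Context: Given $M\in\operatorname{Ob}(\mathbf{Set}_0)$, an $M$-admissible functor $F:\mathbf{Set}_0\to\mathbf{Set}$ is a family of subsets $F(C)\subset\operatorname{Map}(M,C)$ (where $\operatorname{Map}(M,C)$ is the set of all maps from $M$ to $C$), one for each $C\in\operatorname{Ob}(\mathbf{Set}_0)$, such that $f\circ\varepsilon\in F(C')$ for all $C,C'\in\operatorname{Ob}(\mathbf{Set}_0)$, all maps $f:C\to C'$ and all $\varepsilon\in F(C)$. Each map $\varepsilon:M\to C$ defines the partition $\mathcal P_\varepsilon=\{\varepsilon^{-1}(c)\}_{c\in\varepsilon(M)}$ of $M$ into nonempty disjoint subsets. For $k\ge1$, the non-negative integer $\left\{{M\atop k}\right\}_F$ is the number of partitions of $M$ into exactly $k$ nonempty parts which are of the form $\mathcal P_\varepsilon$ for some $\varepsilon\in F([k])$; it is zero for $k>|M|$, so the sum defining $p_F$ is finite.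
   Formalization: M is assumed nonempty: for M = ∅ the claim fails, since F(C) = Map(∅,C) is admissible with |F(C)| = 1, while ∅ has no partition into k ≥ 1 nonempty parts, so p_F = 0. *)

theory Defs
  imports
    "HOL-Library.FuncSet"
    "HOL-Library.Disjoint_Sets"
    "HOL-Computational_Algebra.Polynomial"
begin

text \<open>
  Sets are subsets of an arbitrary type \<open>'a\<close>, which plays the role of the universe. It has to
  contain the positive integers, so an injection \<open>num :: nat \<Rightarrow> 'a\<close> is part of the data and
  \<open>[c] = {1, ..., c}\<close> is the image of \<open>{1..c}\<close>. A full subcategory of sets is given by its
  collection of objects \<open>Ob\<close>; its morphisms \<open>C \<rightarrow> C'\<close> are all the maps, represented (uniquely)
  by the extensional functions \<open>C \<rightarrow>\<^sub>E C'\<close>.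
\<close>

definition std_set :: "(nat \<Rightarrow> 'a) \<Rightarrow> nat \<Rightarrow> 'a set" where
  "std_set num c = num ` {1..c}"

definition is_Set0 :: "(nat \<Rightarrow> 'a) \<Rightarrow> 'a set set \<Rightarrow> bool" where
  "is_Set0 num Ob \<longleftrightarrow>
     inj num \<and> (\<forall>c. std_set num c \<in> Ob) \<and> (\<forall>C\<in>Ob. \<forall>D. D \<subseteq> C \<longrightarrow> D \<in> Ob)"

definition admissible :: "'a set set \<Rightarrow> 'a set \<Rightarrow> ('a set \<Rightarrow> ('a \<Rightarrow> 'a) set) \<Rightarrow> bool" where
  "admissible Ob M F \<longleftrightarrow>
     M \<in> Ob \<and>
     (\<forall>C\<in>Ob. F C \<subseteq> (M \<rightarrow>\<^sub>E C)) \<and>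
     (\<forall>C\<in>Ob. \<forall>C'\<in>Ob. \<forall>f\<in>C \<rightarrow>\<^sub>E C'. \<forall>\<epsilon>\<in>F C. compose M f \<epsilon> \<in> F C')"

definition fibre_partition :: "'a set \<Rightarrow> ('a \<Rightarrow> 'b) \<Rightarrow> 'a set set" where
  "fibre_partition M \<epsilon> = (\<lambda>c. {x\<in>M. \<epsilon> x = c}) ` (\<epsilon> ` M)"

definition F_stirling ::
    "(nat \<Rightarrow> 'a) \<Rightarrow> 'a set \<Rightarrow> ('a set \<Rightarrow> ('a \<Rightarrow> 'a) set) \<Rightarrow> nat \<Rightarrow> nat" where
  "F_stirling num M F k =
     card {P. partition_on M P \<and> card P = k \<and>
              (\<exists>\<epsilon>\<in>F (std_set num k). P = fibre_partition M \<epsilon>)}"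

lemma F_stirling_eq_0:
  assumes "finite M" "k > card M"
  shows "F_stirling num M F k = 0"
proof -
  have "card (fibre_partition M \<epsilon>) \<le> card M" for \<epsilon> :: "'a \<Rightarrow> 'a"
    using card_image_le[OF assms(1), of \<epsilon>]
      card_image_le[OF finite_imageI[OF assms(1)], of "\<lambda>c. {x\<in>M. \<epsilon> x = c}" \<epsilon>]
    unfolding fibre_partition_def by linarith
  then have no_partition: "{P. partition_on M P \<and> card P = k \<and>
      (\<exists>\<epsilon>\<in>F (std_set num k). P = fibre_partition M \<epsilon>)} = {}"
    using assms(2) by (auto simp: not_le[symmetric])
  show ?thesis
    unfolding F_stirling_def no_partition by simp
qed

text \<open>For finite \<open>M\<close>, the sum over all \<open>k \<ge> 1\<close> may stop at \<open>card M\<close> by \<open>F_stirling_eq_0\<close>.\<close>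

definition p_poly ::
    "(nat \<Rightarrow> 'a) \<Rightarrow> 'a set \<Rightarrow> ('a set \<Rightarrow> ('a \<Rightarrow> 'a) set) \<Rightarrow> int poly" where
  "p_poly num M F =
     (\<Sum>k = 1..card M. of_nat (F_stirling num M F k) * (\<Prod>i<k. [:- int i, 1:]))"

end

theory Submission
  imports Defs
begin

text \<open>
  If \<open>\<epsilon>\<close> and \<open>\<epsilon>'\<close> have the same fibres, then \<open>\<epsilon>' = f \<circ> \<epsilon>\<close> for some map \<open>f\<close>, so admissibility makes
  membership in \<open>F\<close> depend on the fibre partition only. Hence \<open>F C\<close> is the disjoint union, over the
  partitions \<open>P\<close> of \<open>M\<close> coming from \<open>F\<close> (all of them already come from \<open>F [k]\<close> with \<open>k = card P\<close>), of
  the maps with fibre partition \<open>P\<close>. The latter are the injections of \<open>P\<close> into \<open>C\<close>, which are counted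
  by a falling factorial.
\<close>

lemma fibre_partition_eqD:
  assumes "fibre_partition M f = fibre_partition M g" "x \<in> M" "y \<in> M" "f x = f y"
  shows "g x = g y"
proof -
  have "{z\<in>M. f z = f x} \<in> fibre_partition M g"
    using assms(2) unfolding assms(1)[symmetric] by (auto simp: fibre_partition_def)
  then obtain c where c: "{z\<in>M. f z = f x} = {z\<in>M. g z = c}"
    by (auto simp: fibre_partition_def)
  have "x \<in> {z\<in>M. f z = f x}" "y \<in> {z\<in>M. f z = f x}"
    using assms by auto
  then show ?thesis
    unfolding c by simp
qed

text \<open>The fibre partition carries the same information as the kernel relation
  \<open>f x = f y\<close> on \<open>M\<close>; the kernel form is the convenient one for
  compositions with injections.\<close>

lemma fibre_partition_eq_iff:
  "fibre_partition M f = fibre_partition M g \<longleftrightarrow> (\<forall>x\<in>M. \<forall>y\<in>M. f x = f y \<longleftrightarrow> g x = g y)"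
proof
  show "\<forall>x\<in>M. \<forall>y\<in>M. f x = f y \<longleftrightarrow> g x = g y"
    if "fibre_partition M f = fibre_partition M g"
    by (intro ballI iffI) (erule fibre_partition_eqD[OF that] fibre_partition_eqD[OF that[symmetric]]; assumption)+
next
  assume eq: "\<forall>x\<in>M. \<forall>y\<in>M. f x = f y \<longleftrightarrow> g x = g y"
  then have "{z\<in>M. f z = f x} = {z\<in>M. g z = g x}" if "x \<in> M" for x
    using that by blast
  then show "fibre_partition M f = fibre_partition M g"
    by (simp add: fibre_partition_def image_image cong: image_cong)
qed

lemma partition_on_fibre_partition: "partition_on M (fibre_partition M f)"
  by (rule partition_onI) (auto simp: fibre_partition_def disjnt_def)

lemma card_fibre_partition: "card (fibre_partition M f) = card (f ` M)"
proof -
  have "inj_on (\<lambda>c. {x\<in>M. f x = c}) (f ` M)"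
    by (rule inj_onI) blast
  then show ?thesis
    by (simp add: fibre_partition_def card_image)
qed

lemma obtain_factorization:
  assumes f: "f \<in> M \<rightarrow>\<^sub>E C" and g: "g \<in> M \<rightarrow>\<^sub>E D" and "D \<noteq> {}"
    and eq: "\<And>x y. x \<in> M \<Longrightarrow> y \<in> M \<Longrightarrow> f x = f y \<Longrightarrow> g x = g y"
  obtains h where "h \<in> C \<rightarrow>\<^sub>E D" "compose M h f = g"
proof -
  obtain d where d: "d \<in> D"
    using \<open>D \<noteq> {}\<close> by blast
  define h where "h = (\<lambda>c\<in>C. if c \<in> f ` M then g (inv_into M f c) else d)"
  have inv: "inv_into M f c \<in> M" if "c \<in> f ` M" for c
    using that by (rule inv_into_into)
  have "h \<in> C \<rightarrow>\<^sub>E D"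
    using PiE_mem[OF g inv] d by (auto simp: h_def)
  moreover have "compose M h f = g"
  proof (rule extensionalityI)
    fix x assume x: "x \<in> M"
    then have "f (inv_into M f (f x)) = f x" "inv_into M f (f x) \<in> M"
      by (auto intro: f_inv_into_f inv)
    then have "g (inv_into M f (f x)) = g x"
      using eq x by blast
    then show "compose M h f x = g x"
      using x f by (auto simp: compose_def h_def)
  qed (use g in \<open>auto simp: PiE_def\<close>)
  ultimately show ?thesis
    by (rule that)
qed

text \<open>The product is over the integers, to match the values of \<open>p_poly\<close>, whereas
  the library count uses truncated subtraction.\<close>

lemma card_injections:
  assumes "finite A" "finite B"
  shows "int (card {f \<in> A \<rightarrow>\<^sub>E B. inj_on f A}) = (\<Prod>i<card A. int (card B) - int i)"
proof -
  have *: "int (card {f \<in> A \<rightarrow>\<^sub>E B. inj_on f A}) = (\<Prod>i<card A. int (card B - i))"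
    using card_inj_on_subset_funcset[OF assms subset_refl] by (simp add: atLeast0LessThan)
  show ?thesis
  proof (cases "card A \<le> card B")
    case True
    then show ?thesis
      unfolding * by (intro prod.cong) auto
  next
    case False
    \<comment> \<open>When \<open>A\<close> is larger than \<open>B\<close>, the factor at
      \<open>i = card B\<close> kills both products, so later negative factors do no harm.\<close>
    then have "\<exists>i\<in>{..<card A}. int (card B - i) = 0" "\<exists>i\<in>{..<card A}. int (card B) - int i = 0"
      by (auto intro!: bexI[of _ "card B"])
    then have "(\<Prod>i<card A. int (card B - i)) = 0" "(\<Prod>i<card A. int (card B) - int i) = 0"
      by (meson finite_lessThan prod_zero)+
    then show ?thesis
      unfolding * by (simp only:)
  qed
qed

text \<open>Composing with \<open>g\<close> turns injections of \<open>g\<close>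
  M\<open>into\<close>C\<open>bijectively into maps with the fibres of\<close>g\<open>, and\<close>g
  \<open>M\<close> has one point per block.\<close>

lemma card_maps_with_fibre_partition:
  assumes "finite M" "finite C"
  shows "int (card {f \<in> M \<rightarrow>\<^sub>E C. fibre_partition M f = fibre_partition M g})
    = (\<Prod>i<card (fibre_partition M g). int (card C) - int i)"
proof -
  let ?I = "{h \<in> g ` M \<rightarrow>\<^sub>E C. inj_on h (g ` M)}"
  let ?E = "{f \<in> M \<rightarrow>\<^sub>E C. fibre_partition M f = fibre_partition M g}"
  have "bij_betw (\<lambda>h. compose M h g) ?I ?E"
  proof (rule bij_betw_imageI)
    show "inj_on (\<lambda>h. compose M h g) ?I"
    proof (rule inj_onI)
      fix h h' assume h: "h \<in> ?I" "h' \<in> ?I" and eq: "compose M h g = compose M h' g"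
      show "h = h'"
      proof (rule extensionalityI)
        fix c assume "c \<in> g ` M"
        then obtain x where "x \<in> M" "c = g x"
          by blast
        then show "h c = h' c"
          using fun_cong[OF eq, of x] by (simp add: compose_eq)
      qed (use h in \<open>auto simp: PiE_def\<close>)
    qed
    show "(\<lambda>h. compose M h g) ` ?I = ?E"
    proof (intro equalityI subsetI)
      fix f assume "f \<in> (\<lambda>h. compose M h g) ` ?I"
      then show "f \<in> ?E"
        by (auto simp: fibre_partition_eq_iff compose_def inj_on_eq_iff)
    next
      fix f assume "f \<in> ?E"
      then have f: "f \<in> M \<rightarrow>\<^sub>E C" and eq: "\<And>x y. x \<in> M \<Longrightarrow> y \<in> M \<Longrightarrow> f x = f y \<longleftrightarrow> g x = g y"
        by (auto simp: fibre_partition_eq_iff)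
      \<comment> \<open>The inverse sends a value of \<open>g\<close> to the constant value of
        \<open>f\<close> on that fibre.\<close>
      define h where "h = (\<lambda>c\<in>g ` M. f (inv_into M g c))"
      have h: "h (g x) = f x" if "x \<in> M" for x
        using that eq[of "inv_into M g (g x)" x]
        by (simp add: h_def inv_into_into f_inv_into_f)
      have "h \<in> extensional (g ` M)"
        by (simp add: h_def)
      moreover have "h c \<in> C" if "c \<in> g ` M" for c
        using that PiE_mem[OF f] h by force
      moreover have "inj_on h (g ` M)"
        using eq h by (auto intro!: inj_onI)
      ultimately have "h \<in> ?I"
        by (simp add: PiE_iff)
      moreover have "compose M h g = f"
        by (rule extensionalityI[of _ M]) (use f h in \<open>auto simp: compose_def PiE_def\<close>)
      ultimately show "f \<in> (\<lambda>h. compose M h g) ` ?I"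
        by blast
    qed
  qed
  then have "card ?E = card ?I"
    by (rule bij_betw_same_card[symmetric])
  then show ?thesis
    using assms by (simp add: card_injections card_fibre_partition)
qed

text \<open>Functoriality enters here: \<open>g\<close> factors through \<open>f\<close>. A map from
  a nonempty \<open>M\<close> to \<open>D\<close> forces \<open>D\<close> to be nonempty, as the
  factorization requires.\<close>

lemma admissible_fibre_partition:
  assumes "admissible Ob M F" "C \<in> Ob" "D \<in> Ob" "M \<noteq> {}"
    and "f \<in> F C" "g \<in> M \<rightarrow>\<^sub>E D" "fibre_partition M g = fibre_partition M f"
  shows "g \<in> F D"
proof -
  have f: "f \<in> M \<rightarrow>\<^sub>E C"
    using assms(1,2,5) by (auto simp: admissible_def)
  have "D \<noteq> {}"
    using assms(4,6) by auto
  then obtain h where h: "h \<in> C \<rightarrow>\<^sub>E D" "compose M h f = g"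
    using fibre_partition_eqD[OF assms(7)[symmetric]] by (rule obtain_factorization[OF f assms(6)])
  have "compose M h f \<in> F D"
    using assms(1,2,3,5) h(1) unfolding admissible_def by blast
  then show ?thesis
    unfolding h(2) .
qed

theorem theorem3p6:
  fixes num :: "nat \<Rightarrow> 'a"
    and Ob :: "'a set set"
    and M C :: "'a set"
    and F :: "'a set \<Rightarrow> ('a \<Rightarrow> 'a) set"
  assumes "is_Set0 num Ob"
    and "finite M" and "M \<noteq> {}"
    and "admissible Ob M F"
    and "C \<in> Ob" and "finite C"
  shows "int (card (F C)) = poly (p_poly num M F) (int (card C))"
proof -
  define S where "S k = {P. partition_on M P \<and> card P = k \<and>
      (\<exists>\<epsilon>\<in>F (std_set num k). P = fibre_partition M \<epsilon>)}" for k
  define E where "E P = {f \<in> M \<rightarrow>\<^sub>E C. fibre_partition M f = P}" for P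
  have std_Ob: "std_set num k \<in> Ob" for k
    using assms(1) by (simp add: is_Set0_def)
  have card_std: "card (std_set num k) = k" for k
    using assms(1) card_image[OF inj_on_subset[OF _ subset_UNIV], of num "{1..k}"]
    by (simp add: is_Set0_def std_set_def)
  have fin_S: "finite (S k)" for k
    by (rule finite_subset[OF _ finitely_many_partition_on[OF assms(2)]]) (auto simp: S_def)
  have fin_E: "finite (E P)" for P
    using assms(2,6) by (auto simp: E_def intro!: finite_PiE)
  have F_C: "F C = (\<Union>k\<in>{1..card M}. \<Union>P\<in>S k. E P)"
  proof (intro equalityI subsetI)
    fix f assume f: "f \<in> F C"
    then have fMC: "f \<in> M \<rightarrow>\<^sub>E C"
      using assms(4,5) by (auto simp: admissible_def)
    define k where "k = card (f ` M)"
    \<comment> \<open>The lower bound 1, where the sum in \<open>p_poly\<close> starts, comes from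
      \<open>M \<noteq> {}\<close>.\<close>
    have k: "k \<in> {1..card M}"
      using assms(2,3) by (auto simp: k_def card_image_le Suc_le_eq card_gt_0_iff)
    have "finite (f ` M)" "finite (std_set num k)" "card (f ` M) = card (std_set num k)"
      using assms(2) by (simp_all only: card_std k_def) (simp_all add: std_set_def)
    \<comment> \<open>Relabelling the image of \<open>f\<close> by \<open>[k]\<close> keeps the
      fibres, so the partition of \<open>f\<close> is already realized in
      \<open>F [k]\<close>.\<close>
    then obtain b where b: "bij_betw b (f ` M) (std_set num k)"
      using finite_same_card_bij by blast
    define g where "g = compose M b f"
    have g: "g \<in> M \<rightarrow>\<^sub>E std_set num k"
      using bij_betw_apply[OF b] by (auto simp: g_def compose_def)
    have eq: "fibre_partition M g = fibre_partition M f"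
      using bij_betw_imp_inj_on[OF b]
      by (auto simp: fibre_partition_eq_iff g_def compose_def inj_on_eq_iff)
    have "g \<in> F (std_set num k)"
      by (rule admissible_fibre_partition[OF assms(4,5) std_Ob assms(3) f g eq])
    then have "fibre_partition M f \<in> S k"
      using eq
      by (auto simp: S_def partition_on_fibre_partition card_fibre_partition k_def[symmetric])
    then show "f \<in> (\<Union>k\<in>{1..card M}. \<Union>P\<in>S k. E P)"
      using k fMC by (auto simp: E_def)
  next
    fix f assume "f \<in> (\<Union>k\<in>{1..card M}. \<Union>P\<in>S k. E P)"
    then show "f \<in> F C"
      using admissible_fibre_partition[OF assms(4) std_Ob assms(5,3)]
      by (auto simp: S_def E_def)
  qed
  have card_E: "int (card (E P)) = (\<Prod>i<k. int (card C) - int i)" if "P \<in> S k" for P k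
    using that card_maps_with_fibre_partition[OF assms(2,6)] by (auto simp: S_def E_def)
  \<comment> \<open>Disjointness holds because \<open>f\<close> determines its partition
    \<open>P\<close>, and \<open>P\<close> determines \<open>k = card P\<close>.\<close>
  have "card (F C) = (\<Sum>k\<in>{1..card M}. card (\<Union>P\<in>S k. E P))"
    unfolding F_C using fin_S fin_E
    by (intro card_UN_disjoint) (auto simp: S_def E_def)
  also have "\<dots> = (\<Sum>k\<in>{1..card M}. \<Sum>P\<in>S k. card (E P))"
    using fin_S fin_E by (intro sum.cong refl card_UN_disjoint) (auto simp: E_def)
  finally have "int (card (F C)) = (\<Sum>k\<in>{1..card M}. \<Sum>P\<in>S k. int (card (E P)))"
    by simp
  also have "\<dots> = (\<Sum>k\<in>{1..card M}. int (card (S k)) * (\<Prod>i<k. int (card C) - int i))"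
    by (simp add: card_E)
  also have "\<dots> = poly (p_poly num M F) (int (card C))"
    by (simp add: p_poly_def F_stirling_def S_def poly_sum poly_prod of_nat_poly)
  finally show ?thesis .
qed

end
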